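(* Let $\Gamma$ be a metric Jordan curve. Then $\Gamma$ is bounded turning if and only if there exists a weak-quasisymmetric homeomorphism $\varphi\colon \mathsf{S}^1\to\Gamma$.
   Context: A metric Jordan curve is a metric space homeomorphic to the circle. All metrics are written $|x-y|$. A metric Jordan curve $\Gamma$ is bounded turning if there is a constant $C\ge 1$ such that for each pair of points $x,y\in\Gamma$ the arc $\Gamma[x,y]\subset\Gamma$ of smaller diameter between $x$ and $y$ satisfies $\operatorname{diam}\Gamma[x,y]\le C|x-y|$. A homeomorphism $\varphi\colon X\to Y$ of metric spaces is weak-quasisymmetric if there is a constant $H\ge 1$ such that for all $x,y,z\in X$: $|x-y|\le |x-z|$ implies $|\varphi(x)-\varphi(y)|\le H|\varphi(x)-\varphi(z)|$. The unit circle is $\mathsf{S}^1=[0,1]/\{0\sim 1\}$, equipped with the arc-length metric $\lambda(s,t)=\min\{|t-s|,\,|s+(1-t)|\}$ for $0\le s\le t\le 1$. *)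

theory Defs
  imports "HOL-Analysis.Analysis"
begin

text \<open>
  A metric Jordan curve is rendered as a set \<open>\<Gamma>\<close> in a type of class \<open>metric_space\<close>, with the
  induced metric; since the type is arbitrary, this covers every metric space.
\<close>

definition metric_Jordan_curve :: "'a::metric_space set \<Rightarrow> bool"
  where "metric_Jordan_curve \<Gamma> \<longleftrightarrow> \<Gamma> homeomorphic sphere (0::complex) 1"

definition arcs_between :: "'a::metric_space set \<Rightarrow> 'a \<Rightarrow> 'a \<Rightarrow> 'a set set"
  where "arcs_between \<Gamma> x y =
    {path_image g | g. arc g \<and> path_image g \<subseteq> \<Gamma> \<and> pathstart g = x \<and> pathfinish g = y}"

text \<open>
  On a Jordan curve and for \<open>x \<noteq> y\<close> there are exactly two arcs between \<open>x\<close> and \<open>y\<close>. If they have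
  the same diameter, then either of them may serve as \<open>\<Gamma>[x,y]\<close>.
\<close>

definition is_smaller_arc :: "'a::metric_space set \<Rightarrow> 'a \<Rightarrow> 'a \<Rightarrow> 'a set \<Rightarrow> bool"
  where "is_smaller_arc \<Gamma> x y A \<longleftrightarrow>
    A \<in> arcs_between \<Gamma> x y \<and> (\<forall>B \<in> arcs_between \<Gamma> x y. diameter A \<le> diameter B)"

text \<open>
  The condition is void for \<open>x = y\<close>, where \<open>\<Gamma>[x,x]\<close> is the degenerate arc \<open>{x}\<close> of diameter \<open>0\<close>;
  the library's \<open>arc\<close> is injective and so excludes degenerate arcs.
\<close>

definition bounded_turning :: "'a::metric_space set \<Rightarrow> bool"
  where "bounded_turning \<Gamma> \<longleftrightarrow>
    (\<exists>C\<ge>1. \<forall>x\<in>\<Gamma>. \<forall>y\<in>\<Gamma>. x \<noteq> y \<longrightarrow>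
      (\<exists>A. is_smaller_arc \<Gamma> x y A \<and> diameter A \<le> C * dist x y))"

definition weak_quasisymmetric_homeomorphism ::
    "'a::metric_space set \<Rightarrow> 'b::metric_space set \<Rightarrow> ('a \<Rightarrow> 'b) \<Rightarrow> bool"
  where "weak_quasisymmetric_homeomorphism X Y \<phi> \<longleftrightarrow>
    (\<exists>\<psi>. homeomorphism X Y \<phi> \<psi>) \<and>
    (\<exists>H\<ge>1. \<forall>x\<in>X. \<forall>y\<in>X. \<forall>z\<in>X.
      dist x y \<le> dist x z \<longrightarrow> dist (\<phi> x) (\<phi> y) \<le> H * dist (\<phi> x) (\<phi> z))"

definition circle_rel :: "real \<Rightarrow> real \<Rightarrow> bool"
  where "circle_rel s t \<longleftrightarrow> s \<in> {0..1} \<and> t \<in> {0..1} \<and> (s = t \<or> {s, t} = {0, 1})"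

text \<open>The unit circle \<open>[0,1]/{0 \<sim> 1}\<close>, of total length \<open>1\<close>.\<close>

quotient_type S1 = real / partial: circle_rel
proof (rule part_equivpI)
  show "\<exists>x. circle_rel x x"
    by (rule exI[of _ 0]) (simp add: circle_rel_def)
  show "symp circle_rel"
    by (auto simp: symp_def circle_rel_def insert_commute)
  show "transp circle_rel"
    by (auto simp: transp_def circle_rel_def doubleton_eq_iff)
qed

definition arc_length_dist :: "real \<Rightarrow> real \<Rightarrow> real"
  where "arc_length_dist s t =
    (if s \<le> t then min \<bar>t - s\<bar> \<bar>s + (1 - t)\<bar> else min \<bar>s - t\<bar> \<bar>t + (1 - s)\<bar>)"

instantiation S1 :: metric_space
begin

lift_definition dist_S1 :: "S1 \<Rightarrow> S1 \<Rightarrow> real" is arc_length_dist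
  by (auto simp: circle_rel_def arc_length_dist_def doubleton_eq_iff)

definition uniformity_S1 :: "(S1 \<times> S1) filter"
  where "uniformity_S1 = (INF e\<in>{0<..}. principal {(x, y). dist x y < e})"

definition open_S1 :: "S1 set \<Rightarrow> bool"
  where "open_S1 U \<longleftrightarrow> (\<forall>x\<in>U. eventually (\<lambda>(x', y). x' = x \<longrightarrow> y \<in> U) uniformity)"

instance
proof
  fix x y z :: S1
  show "dist x y = 0 \<longleftrightarrow> x = y"
    by transfer (auto simp: circle_rel_def arc_length_dist_def doubleton_eq_iff min_def
        split: if_splits)
  show "dist x y \<le> dist x z + dist y z"
    by transfer (auto simp: circle_rel_def arc_length_dist_def min_def abs_if)
qed (rule uniformity_S1_def open_S1_def)+

end

end

theory Submission
  imports Defs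
begin

text \<open>
  Parametrize the curve by a \<open>1\<close>-periodic map \<open>\<gamma>\<close> on the line, injective modulo \<open>1\<close>, and let
  \<open>D s t\<close> be the diameter of \<open>\<gamma> ` [s, t]\<close>.

  A weak-quasisymmetric image of the circle is bounded turning because the image of a short arc from
  \<open>s\<close> to \<open>t\<close> lies in a ball about \<open>\<phi> s\<close> whose radius is a multiple of \<open>|\<phi> s - \<phi> t|\<close>
  (\<open>weak_quasisymmetric_imp_bounded_turning\<close>). That a smaller arc exists at all follows from a
  connectedness argument: an arc in the curve with given end points contains the image of one of the
  two parameter intervals (\<open>connected_contains_arc\<close>, \<open>smaller_arc_exists\<close>).

  For the converse, the curve is reparametrized by repeated subdivision. By the intermediate value
  theorem, an interval \<open>[a, b]\<close> can be cut at \<open>c < d\<close> so that \<open>D a c = D d b = D a b / 3\<close>; the middle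
  piece then satisfies \<open>D a b / 3 \<le> D c d \<le> D a b\<close>. The three pieces receive equal length
  in the new parameter. Thus new triadic intervals of equal length which are adjacent have
  images of comparable diameter, with constant \<open>3\<close> at every depth: two pieces of the same
  interval by construction, and two pieces on different sides of an old division point because
  both diameters have been divided by exactly \<open>3\<close> (\<open>p_adjacent\<close>). No bound on the number of
  pieces of small diameter is needed, so curves that are not doubling are covered. The division points
  are dense (\<open>p_dense\<close>), so the new parameter is a homeomorphic change of the old one
  (\<open>order_isomorphism_extension\<close>, \<open>balanced_reparametrization\<close>). It follows that \<open>[x - r, x]\<close>,
  \<open>[x, x + r]\<close> and \<open>[x - r, x + r]\<close> have images of comparable diameter for all \<open>x\<close> and
  \<open>0 < r \<le> 1/2\<close> (\<open>D_sym_le\<close>). On a bounded turning curve the distance of two points is comparable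
  to the smaller diameter of the two arcs between them, which turns this into weak quasisymmetry
  (\<open>bounded_turning_imp_weak_quasisymmetric\<close>).
\<close>

section \<open>Extending order isomorphisms between dense sets\<close>

text \<open>
  An order isomorphism between two dense sets of reals, given by indexed families \<open>Q\<close> and \<open>P\<close>,
  extends to an increasing bijection of the line, \<open>u \<theta> = sup {P i | Q i \<le> \<theta>}\<close>.
\<close>

lemma order_isomorphism_extension:
  fixes P Q :: "'i \<Rightarrow> real"
  assumes order: "\<And>i j. P i \<le> P j \<longleftrightarrow> Q i \<le> Q j"
    and denseP: "\<And>s t. s < t \<Longrightarrow> \<exists>i. s < P i \<and> P i < t"
    and denseQ: "\<And>s t. s < t \<Longrightarrow> \<exists>i. s < Q i \<and> Q i < t"
  obtains u :: "real \<Rightarrow> real"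
  where "strict_mono u" "surj u" "\<And>i. u (Q i) = P i"
proof -
  define u where "u = (\<lambda>\<theta>. Sup {P i | i. Q i \<le> \<theta>})"
  have less: "P i < P j \<longleftrightarrow> Q i < Q j" for i j
    using order[of j i] by linarith
  have bdd: "bdd_above {P i | i. Q i \<le> \<theta>}" for \<theta>
  proof -
    obtain j where j: "\<theta> < Q j" using denseQ[of \<theta> "\<theta> + 1"] by auto
    show ?thesis
      by (rule bdd_aboveI[of _ "P j"]) (use j order in \<open>force intro: order_trans\<close>)
  qed
  have upper: "P i \<le> u \<theta>" if "Q i \<le> \<theta>" for i \<theta>
    unfolding u_def using bdd that by (intro cSup_upper) auto
  have least: "u \<theta> \<le> z" if "\<And>i. Q i \<le> \<theta> \<Longrightarrow> P i \<le> z" for \<theta> z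
  proof -
    obtain j where "Q j < \<theta>" using denseQ[of "\<theta> - 1" \<theta>] by auto
    then have "{P i | i. Q i \<le> \<theta>} \<noteq> {}" by (auto intro: less_imp_le)
    then show ?thesis unfolding u_def using that by (intro cSup_least) auto
  qed
  have uQ: "u (Q i) = P i" for i
    by (rule antisym[OF least upper]) (auto simp: order)
  have mono: "strict_mono u"
  proof (rule strict_monoI)
    fix s t :: real assume "s < t"
    then obtain i where i: "s < Q i" "Q i < t" using denseQ by blast
    then obtain j where j: "Q i < Q j" "Q j < t" using denseQ by blast
    have "u s \<le> P i" by (rule least) (use i order in \<open>force intro: order_trans\<close>)
    also have "\<dots> < P j" using j less by blast
    also have "\<dots> \<le> u t" using j by (intro upper) auto
    finally show "u s < u t" .
  qed
  have "\<exists>\<theta>. u \<theta> = t" for t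
  proof -
    define T where "T = {Q i | i. P i \<le> t}"
    have bddT: "bdd_above T"
    proof -
      obtain j where j: "t < P j" using denseP[of t "t + 1"] by auto
      show ?thesis 
      proof (rule bdd_aboveI[of _ "Q j"])
        fix q assume "q \<in> T"
        then obtain i where "q = Q i" "P i \<le> t" by (auto simp: T_def)
        with j show "q \<le> Q j" using order[of i j] by simp
      qed
    qed
    obtain j where "P j < t" using denseP[of "t - 1" t] by auto
    then have neT: "T \<noteq> {}" unfolding T_def by (auto intro: less_imp_le)
    have "\<not> u (Sup T) < t"
    proof
      assume "u (Sup T) < t"
      then obtain i where i: "u (Sup T) < P i" "P i < t" using denseP by blast
      have "Q i \<le> Sup T" using i bddT by (intro cSup_upper) (auto simp: T_def)
      then show False using upper[of i "Sup T"] i by linarith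
    qed
    moreover have "\<not> t < u (Sup T)"
    proof
      assume "t < u (Sup T)"
      then obtain i where i: "t < P i" "P i < u (Sup T)" using denseP by blast
      have "Sup T \<le> Q i"
      proof (rule cSup_least[OF neT])
        fix q assume "q \<in> T"
        then obtain j where "q = Q j" "P j \<le> t" by (auto simp: T_def)
        with i show "q \<le> Q i" using order[of j i] by simp
      qed
      then have "u (Sup T) \<le> u (Q i)" using mono by (simp add: strict_mono_less_eq)
      then show False using i uQ by simp
    qed
    ultimately show ?thesis by (meson linorder_cases)
  qed
  then have "surj u" by (metis surj_def)
  with mono uQ show ?thesis using that by blast
qed

section \<open>Diameters along a periodic parametrization\<close>

lemma not_Ints_between: "\<lbrakk>0 < d; d < 1\<rbrakk> \<Longrightarrow> d \<notin> \<int>" for d :: real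
  by (auto elim!: Ints_cases)

lemma Ints_abs_less_1: "\<lbrakk>d \<in> \<int>; \<bar>d\<bar> < 1\<rbrakk> \<Longrightarrow> d = 0" for d :: real
  by (auto elim!: Ints_cases)

text \<open>
  A \<open>loop\<close> is the lift to the real line of a homeomorphism from the circle of length \<open>1\<close> onto
  \<open>range \<gamma>\<close>. On the line, arcs of the curve are images of intervals, and no case distinction at
  the base point of the circle is needed.
\<close>

locale loop =
  fixes \<gamma> :: "real \<Rightarrow> 'a::metric_space"
  assumes continuous: "continuous_on UNIV \<gamma>"
    and eq_iff: "\<gamma> s = \<gamma> t \<longleftrightarrow> s - t \<in> \<int>"
begin

text \<open>
  The diameter of the image of an interval. If \<open>t \<ge> s + 1\<close>, then the image is the whole curve.
\<close>

definition D :: "real \<Rightarrow> real \<Rightarrow> real"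
  where "D s t = diameter (\<gamma> ` {s..t})"

lemma shift: "\<gamma> (t + of_int m) = \<gamma> t"
  by (simp add: eq_iff)

lemma compact_image: "compact K \<Longrightarrow> compact (\<gamma> ` K)"
  by (meson compact_continuous_image continuous continuous_on_subset subset_UNIV)

lemma bounded_image [simp]: "bounded (\<gamma> ` {s..t})"
  by (simp add: compact_image compact_imp_bounded)

lemma dist_le_D: "\<lbrakk>x \<in> {s..t}; y \<in> {s..t}\<rbrakk> \<Longrightarrow> dist (\<gamma> x) (\<gamma> y) \<le> D s t"
  unfolding D_def by (intro diameter_bounded_bound) auto

lemma D_leI:
  assumes "s \<le> t" "\<And>x y. \<lbrakk>x \<in> {s..t}; y \<in> {s..t}\<rbrakk> \<Longrightarrow> dist (\<gamma> x) (\<gamma> y) \<le> d"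
  shows "D s t \<le> d"
  using assms by (auto simp: D_def diameter_def intro!: cSUP_least)

lemma D_nonneg: "0 \<le> D s t"
  by (simp add: D_def diameter_ge_0)

lemma D_refl [simp]: "D s s = 0"
  by (simp add: D_def)

lemma D_mono: "\<lbrakk>s' \<le> s; t \<le> t'\<rbrakk> \<Longrightarrow> D s t \<le> D s' t'"
  unfolding D_def by (intro diameter_subset image_mono) auto

lemma D_triangle:
  assumes "s \<le> t" "t \<le> r"
  shows "D s r \<le> D s t + D t r"
proof (rule D_leI)
  have *: "dist (\<gamma> x) (\<gamma> y) \<le> D s t + D t r" if "x \<in> {s..r}" "y \<in> {s..r}" "x \<le> y" for x y
  proof -
    consider "y \<le> t" | "x \<le> t" "t \<le> y" | "t \<le> x" by linarith
    then show ?thesis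
    proof cases
      case 1
      then show ?thesis using dist_le_D[of x s t y] D_nonneg[of t r] that by auto
    next
      case 2
      then have "dist (\<gamma> x) (\<gamma> t) \<le> D s t" "dist (\<gamma> t) (\<gamma> y) \<le> D t r"
        using that by (auto intro!: dist_le_D)
      then show ?thesis using dist_triangle[of "\<gamma> x" "\<gamma> y" "\<gamma> t"] by linarith
    next
      case 3
      then show ?thesis using dist_le_D[of x t r y] D_nonneg[of s t] that by auto
    qed
  qed
  fix x y assume "x \<in> {s..r}" "y \<in> {s..r}"
  then show "dist (\<gamma> x) (\<gamma> y) \<le> D s t + D t r"
    using *[of x y] *[of y x] by (cases "x \<le> y") (auto simp: dist_commute)
qed (use assms in simp)

lemma D_pos:
  assumes "s < t" shows "0 < D s t"
proof -
  define r where "r = min t (s + 1/2)"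
  have "r - s \<notin> \<int>"
  proof
    assume "r - s \<in> \<int>"
    moreover have "0 < r - s" "r - s < 1" using assms by (auto simp: r_def)
    ultimately show False by (auto elim!: Ints_cases)
  qed
  then have "0 < dist (\<gamma> r) (\<gamma> s)" by (simp add: eq_iff)
  also have "\<dots> \<le> D s t" using assms by (intro dist_le_D) (auto simp: r_def)
  finally show ?thesis .
qed

lemma image_shift: "\<gamma> ` {s + of_int m..t + of_int m} = \<gamma> ` {s..t}"
proof -
  have "{s + of_int m..t + of_int m} = (\<lambda>x. x + of_int m) ` {s..t}" by simp
  then show ?thesis by (simp only: image_image shift)
qed

lemma D_shift: "D (s + of_int m) (t + of_int m) = D s t"
  by (simp only: D_def image_shift)

text \<open>Short intervals have small images, uniformly on a compact part \<open>[a, b]\<close> of the line.\<close>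

lemma D_small:
  assumes "0 < e"
  obtains \<delta> where "0 < \<delta>" "\<And>s t. \<lbrakk>a \<le> s; s \<le> t; t \<le> b; t - s < \<delta>\<rbrakk> \<Longrightarrow> D s t < e"
proof -
  have "uniformly_continuous_on {a..b} \<gamma>"
    by (rule compact_uniformly_continuous) (auto intro: continuous_on_subset[OF continuous])
  moreover have "0 < e/2" using assms by simp
  ultimately obtain \<delta> where \<delta>: "0 < \<delta>"
    "\<And>x y. \<lbrakk>x \<in> {a..b}; y \<in> {a..b}; dist y x < \<delta>\<rbrakk> \<Longrightarrow> dist (\<gamma> y) (\<gamma> x) < e/2"
    unfolding uniformly_continuous_on_def by metis
  have "D s t < e" if "a \<le> s" "s \<le> t" "t \<le> b" "t - s < \<delta>" for s t
  proof -
    have "D s t \<le> e/2"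
    proof (rule D_leI[OF that(2)])
      fix x y assume "x \<in> {s..t}" "y \<in> {s..t}"
      then show "dist (\<gamma> x) (\<gamma> y) \<le> e/2"
        using that by (intro less_imp_le \<delta>(2)) (auto simp: dist_real_def)
    qed
    with assms show ?thesis by simp
  qed
  with \<delta>(1) show ?thesis using that by blast
qed

lemma continuous_D_right: "continuous_on {a..b} (\<lambda>t. D a t)"
proof (rule uniformly_continuous_imp_continuous, unfold uniformly_continuous_on_def, safe)
  fix e :: real assume "0 < e"
  then obtain \<delta> where \<delta>: "0 < \<delta>" "\<And>s t. \<lbrakk>a \<le> s; s \<le> t; t \<le> b; t - s < \<delta>\<rbrakk> \<Longrightarrow> D s t < e"
    using D_small by blast
  have *: "\<bar>D a t - D a s\<bar> < e" if "a \<le> s" "s \<le> t" "t \<le> b" "t - s < \<delta>" for s t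
    using \<delta>(2)[OF that] D_triangle[OF that(1,2)] D_mono[of a a s t] that by auto
  have "dist (D a t) (D a s) < e" if "s \<in> {a..b}" "t \<in> {a..b}" "dist t s < \<delta>" for s t
    using *[of s t] *[of t s] that by (cases "s \<le> t") (auto simp: dist_real_def)
  with \<delta>(1) show "\<exists>d>0. \<forall>x\<in>{a..b}. \<forall>x'\<in>{a..b}. dist x' x < d \<longrightarrow> dist (D a x') (D a x) < e"
    by blast
qed

lemma continuous_D_left: "continuous_on {a..b} (\<lambda>t. D t b)"
proof (rule uniformly_continuous_imp_continuous, unfold uniformly_continuous_on_def, safe)
  fix e :: real assume "0 < e"
  then obtain \<delta> where \<delta>: "0 < \<delta>" "\<And>s t. \<lbrakk>a \<le> s; s \<le> t; t \<le> b; t - s < \<delta>\<rbrakk> \<Longrightarrow> D s t < e"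
    using D_small by blast
  have *: "\<bar>D t b - D s b\<bar> < e" if "a \<le> s" "s \<le> t" "t \<le> b" "t - s < \<delta>" for s t
    using \<delta>(2)[OF that] D_triangle[OF that(2,3)] D_mono[of s t b b] that by auto
  have "dist (D t b) (D s b) < e" if "s \<in> {a..b}" "t \<in> {a..b}" "dist t s < \<delta>" for s t
    using *[of s t] *[of t s] that by (cases "s \<le> t") (auto simp: dist_real_def)
  with \<delta>(1) show "\<exists>d>0. \<forall>x\<in>{a..b}. \<forall>x'\<in>{a..b}. dist x' x < d \<longrightarrow> dist (D x' b) (D x b) < e"
    by blast
qed

text \<open>
  The points \<open>c < d\<close> cut \<open>[a, b]\<close> into three intervals, the outer two of which have exactly a third
  of the diameter of the whole. The middle one has between a third and all of it.
\<close>

definition third_cut :: "real \<Rightarrow> real \<Rightarrow> real \<Rightarrow> real \<Rightarrow> bool"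
  where "third_cut a b c d \<longleftrightarrow> a < c \<and> c < d \<and> d < b \<and> D a c = D a b / 3 \<and> D d b = D a b / 3"

lemma third_cut_exists:
  assumes "a < b"
  shows "\<exists>c d. third_cut a b c d"
proof -
  note pos = D_pos[OF assms]
  obtain c where c: "a \<le> c" "c \<le> b" "D a c = D a b / 3"
    using IVT'[of "\<lambda>t. D a t" a "D a b / 3" b] continuous_D_right pos assms by auto
  obtain d where d: "a \<le> d" "d \<le> b" "D d b = D a b / 3"
    using IVT2'[of "\<lambda>t. D t b" b "D a b / 3" a] continuous_D_left pos assms by auto
  have "a \<noteq> c" "d \<noteq> b" using c d pos by auto
  moreover have "c < d"
    using D_triangle[of a c b] D_mono[of d c b b] c d pos by (cases "c < d") auto
  ultimately show ?thesis using c d unfolding third_cut_def by (intro exI[of _ c] exI[of _ d]) auto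
qed

lemma third_cut_middle:
  assumes "third_cut a b c d"
  shows "D a b / 3 \<le> D c d" "D c d \<le> D a b"
  using assms D_triangle[of a c b] D_triangle[of c d b] D_mono[of a c d b]
  by (auto simp: third_cut_def)

lemma third_cut_shift:
  "third_cut (a + of_int m) (b + of_int m) (c + of_int m) (d + of_int m) = third_cut a b c d"
  by (simp add: third_cut_def D_shift)

text \<open>
  The cuts can be chosen equivariantly under integer translations: a choice is made for
  \<open>0 \<le> a < 1\<close> and then transported.
\<close>

lemma periodic_third_cuts:
  obtains f g :: "real \<Rightarrow> real \<Rightarrow> real" where
    "\<And>a b. a < b \<Longrightarrow> third_cut a b (f a b) (g a b)"
    "\<And>a b m. f (a + of_int m) (b + of_int m) = f a b + of_int m"
    "\<And>a b m. g (a + of_int m) (b + of_int m) = g a b + of_int m"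
proof -
  obtain f g where fg: "\<And>a b. a < b \<Longrightarrow> third_cut a b (f a b) (g a b)"
    using third_cut_exists by metis
  define f' g' :: "real \<Rightarrow> real \<Rightarrow> real" where "f' = (\<lambda>a b::real. f (frac a) (b - \<lfloor>a\<rfloor>) + \<lfloor>a\<rfloor>)"
    and "g' = (\<lambda>a b::real. g (frac a) (b - \<lfloor>a\<rfloor>) + \<lfloor>a\<rfloor>)"
  show ?thesis
  proof (rule that)
    fix a b :: real assume "a < b"
    then have "third_cut (frac a) (b - \<lfloor>a\<rfloor>) (f (frac a) (b - \<lfloor>a\<rfloor>)) (g (frac a) (b - \<lfloor>a\<rfloor>))"
      by (intro fg) (simp add: frac_def)
    then show "third_cut a b (f' a b) (g' a b)"
      by (subst (asm) third_cut_shift[of _ "\<lfloor>a\<rfloor>", symmetric]) (simp add: f'_def g'_def frac_def)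
  qed (simp_all add: f'_def g'_def frac_def)
qed

end

section \<open>Triadic subdivision\<close>

lemma int_mod3_cases:
  fixes k :: int
  obtains j where "k = 3 * j" | j where "k = 3 * j + 1" | j where "k = 3 * j + 2"
proof -
  have "k = 3 * (k div 3) \<or> k = 3 * (k div 3) + 1 \<or> k = 3 * (k div 3) + 2" by presburger
  then show ?thesis using that by blast
qed

locale triadic_subdivision = loop +
  fixes f g :: "real \<Rightarrow> real \<Rightarrow> real"
  assumes cut: "a < b \<Longrightarrow> third_cut a b (f a b) (g a b)"
    and f_shift: "f (a + of_int m) (b + of_int m) = f a b + of_int m"
    and g_shift: "g (a + of_int m) (b + of_int m) = g a b + of_int m"
begin

text \<open>
  \<open>p N k\<close> is the point of the old parameter line that is to receive the new parameter \<open>k / 3\<^sup>N\<close>.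
  The integers are kept fixed, and each interval of depth \<open>N\<close> is cut into three of depth \<open>N + 1\<close>.
\<close>

primrec p :: "nat \<Rightarrow> int \<Rightarrow> real"
  where
    "p 0 k = of_int k"
  | "p (Suc N) k =
      (let a = p N (k div 3); b = p N (k div 3 + 1)
       in if k mod 3 = 0 then a else if k mod 3 = 1 then f a b else g a b)"

lemma p_Suc:
  "p (Suc N) (3 * k) = p N k"
  "p (Suc N) (3 * k + 1) = f (p N k) (p N (k + 1))"
  "p (Suc N) (3 * k + 2) = g (p N k) (p N (k + 1))"
  "p (Suc N) (3 * k + 3) = p N (k + 1)"
proof -
  have "(3 * k + 1) div 3 = k" "(3 * k + 1) mod 3 = 1" "(3 * k + 2) div 3 = k" "(3 * k + 2) mod 3 = 2"
    "(3 * k + 3) div 3 = k + 1" "(3 * k + 3) mod 3 = 0"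
    by presburger+
  then show "p (Suc N) (3 * k) = p N k"
    "p (Suc N) (3 * k + 1) = f (p N k) (p N (k + 1))"
    "p (Suc N) (3 * k + 2) = g (p N k) (p N (k + 1))"
    "p (Suc N) (3 * k + 3) = p N (k + 1)"
    by (simp_all add: Let_def)
qed

lemma p_less_Suc: "p N k < p N (k + 1)"
proof (induction N arbitrary: k)
  case (Suc N)
  have *: "third_cut (p N j) (p N (j + 1)) (f (p N j) (p N (j + 1))) (g (p N j) (p N (j + 1)))" for j
    using cut Suc.IH by blast
  show ?case
  proof (cases k rule: int_mod3_cases)
    case (1 j)
    then show ?thesis using *[of j] p_Suc[of N j] by (simp add: third_cut_def del: p.simps)
  next
    case (2 j)
    then show ?thesis using *[of j] p_Suc[of N j] by (simp add: third_cut_def add.assoc del: p.simps)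
  next
    case (3 j)
    then show ?thesis using *[of j] p_Suc[of N j] by (simp add: third_cut_def add.assoc del: p.simps)
  qed
qed simp

lemma p_third_cut: "third_cut (p N k) (p N (k + 1)) (p (Suc N) (3 * k + 1)) (p (Suc N) (3 * k + 2))"
  unfolding p_Suc by (rule cut[OF p_less_Suc])

lemma p_strict_mono: "strict_mono (p N)"
proof (rule strict_monoI)
  fix k l :: int assume "k < l"
  then show "p N k < p N l"
    by (induction rule: int_gr_induct) (use p_less_Suc in \<open>auto intro: less_trans\<close>)
qed

lemma p_shift: "p N (k + m * 3 ^ N) = p N k + of_int m"
proof (induction N arbitrary: k)
  case (Suc N)
  have "k + m * 3 ^ Suc N = k + 3 * (m * 3 ^ N)" by simp
  then have "(k + m * 3 ^ Suc N) div 3 = k div 3 + m * 3 ^ N" "(k + m * 3 ^ Suc N) mod 3 = k mod 3"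
    by presburger+
  moreover have "p N (k div 3 + m * 3 ^ N + 1) = p N (k div 3 + 1) + of_int m"
    using Suc[of "k div 3 + 1"] by (simp add: algebra_simps)
  ultimately show ?case by (simp only: p.simps Let_def Suc f_shift g_shift split: if_split) simp
qed simp

lemma p_refine: "p (N + M) (k * 3 ^ M) = p N k"
proof (induction M)
  case (Suc M)
  then show ?case using p_Suc(1)[of "N + M" "k * 3 ^ M"] by (simp add: mult_ac del: p.simps)
qed simp

lemma p_order: "p N k \<le> p M l \<longleftrightarrow> of_int k / (3::real) ^ N \<le> of_int l / 3 ^ M"
proof -
  have "p N k \<le> p M l \<longleftrightarrow> p (N + M) (k * 3 ^ M) \<le> p (N + M) (l * 3 ^ N)"
    using p_refine[of N M k] p_refine[of M N l] by (simp add: add.commute)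
  also have "\<dots> \<longleftrightarrow> k * 3 ^ M \<le> l * 3 ^ N"
    by (simp add: strict_mono_less_eq[OF p_strict_mono])
  also have "\<dots> \<longleftrightarrow> real_of_int (k * 3 ^ M) \<le> real_of_int (l * 3 ^ N)" by linarith
  also have "\<dots> \<longleftrightarrow> of_int k / (3::real) ^ N \<le> of_int l / 3 ^ M"
    by (simp add: field_simps)
  finally show ?thesis .
qed

text \<open>
  Two adjacent intervals of the same depth have diameters within a factor \<open>3\<close>. For two pieces of
  the same interval this is the property of the cut. If they are pieces of different intervals, then
  both are outer pieces, so their diameters are thirds of the diameters of adjacent intervals of the
  previous depth, and the ratio is inherited.
\<close>

lemma p_adjacent:
  "D (p N k) (p N (k + 1)) \<le> 3 * D (p N (k + 1)) (p N (k + 2)) \<and>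
   D (p N (k + 1)) (p N (k + 2)) \<le> 3 * D (p N k) (p N (k + 1))"
proof (induction N arbitrary: k)
  case 0
  have "D (of_int k) (of_int k + 1) = D 0 1" for k
    using D_shift[of 0 k 1] by (simp add: add.commute)
  from this[of k] this[of "k + 1"] show ?case using D_nonneg[of 0 1]
    by (simp add: algebra_simps)
next
  case (Suc N)
  note gc = p_third_cut[unfolded third_cut_def, of N] third_cut_middle[OF p_third_cut, of N]
  show ?case
  proof (cases k rule: int_mod3_cases)
    case (1 j)
    then show ?thesis using gc[of j] p_Suc(1)[of N j] D_nonneg[of "p N j" "p N (j+1)"]
      by (simp add: add.assoc del: p.simps)
  next
    case (2 j)
    then show ?thesis using gc[of j] p_Suc(4)[of N j] D_nonneg[of "p N j" "p N (j+1)"]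
      by (simp add: add.assoc del: p.simps)
  next
    case (3 j)
    have "3 * j + 4 = 3 * (j + 1) + 1" by simp
    then show ?thesis
      using 3 gc(1)[of j] gc(1)[of "j + 1"] p_Suc(4)[of N j] p_Suc(1)[of N "j+1"] Suc[of j]
      by (simp add: add.assoc del: p.simps)
  qed
qed

text \<open>
  Otherwise some nondegenerate \<open>[s, t]\<close> lies in a nested sequence of subdivision intervals
  \<open>[a N, b N]\<close>, one of each depth. Passing to a middle piece moves the left end by an interval of a
  third of the current diameter, which is bounded below by \<open>D s t / 3\<close>; as the left ends converge,
  this happens only finitely often. Afterwards only outer pieces are chosen, and the diameters
  decay geometrically, below \<open>D s t > 0\<close>.
\<close>

lemma p_dense:
  assumes "s < t"
  shows "\<exists>N k. s < p N k \<and> p N k < t"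
proof (rule ccontr)
  assume none: "\<not> (\<exists>N k. s < p N k \<and> p N k < t)"
  have "\<exists>K. \<forall>N. (p N (K N) \<le> s \<and> s < p N (K N + 1)) \<and>
      (K (Suc N) = 3 * K N \<or> K (Suc N) = 3 * K N + 1 \<or> K (Suc N) = 3 * K N + 2)"
  proof (rule dependent_nat_choice)
    show "\<exists>k. p 0 k \<le> s \<and> s < p 0 (k + 1)"
      by (rule exI[of _ "\<lfloor>s\<rfloor>"]) simp
  next
    fix k N assume k: "p N k \<le> s \<and> s < p N (k + 1)"
    \<comment> \<open>The point \<open>s\<close> lies in one of the three pieces of the interval of depth \<open>N\<close>.\<close>
    consider "s < p (Suc N) (3 * k + 1)"
      | "p (Suc N) (3 * k + 1) \<le> s" "s < p (Suc N) (3 * k + 2)" | "p (Suc N) (3 * k + 2) \<le> s"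
      by linarith
    then show "\<exists>l. (p (Suc N) l \<le> s \<and> s < p (Suc N) (l + 1)) \<and>
        (l = 3 * k \<or> l = 3 * k + 1 \<or> l = 3 * k + 2)"
    proof cases
      case 1
      then show ?thesis using k p_Suc(1)[of N k] by (intro exI[of _ "3 * k"]) (simp del: p.simps)
    next
      case 2
      then show ?thesis by (intro exI[of _ "3 * k + 1"]) (simp add: add.assoc del: p.simps)
    next
      case 3
      then show ?thesis using k p_Suc(4)[of N k]
        by (intro exI[of _ "3 * k + 2"]) (simp add: add.assoc del: p.simps)
    qed
  qed
  then obtain K where K: "\<And>N. p N (K N) \<le> s" "\<And>N. s < p N (K N + 1)"
    and K_Suc: "\<And>N. K (Suc N) = 3 * K N \<or> K (Suc N) = 3 * K N + 1 \<or> K (Suc N) = 3 * K N + 2"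
    by blast
  define a b where "a = (\<lambda>N. p N (K N))" and "b = (\<lambda>N. p N (K N + 1))"
  have t_le: "t \<le> b N" for N
    using none K(2)[of N] unfolding b_def by (meson not_less)
  define \<eta> where "\<eta> = D s t"
  have \<eta>: "0 < \<eta>" "\<eta> \<le> D (a N) (b N)" for N
    using D_pos[OF assms] D_mono[OF K(1) t_le] by (auto simp: \<eta>_def a_def)
  have step: "a N \<le> a (Suc N) \<and>
      (D (a (Suc N)) (b (Suc N)) = D (a N) (b N) / 3 \<or> D (a N) (a (Suc N)) = D (a N) (b N) / 3)" for N
  proof -
    note gc = p_third_cut[unfolded third_cut_def, of N "K N"]
    show ?thesis
      using K_Suc[of N] gc p_Suc(1,4)[of N "K N"] 
      by (auto simp: a_def b_def add.assoc simp del: p.simps)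
  qed
  have "incseq a" using step by (intro incseq_SucI) simp
  then have "convergent a"
    using K(1) by (intro Bseq_mono_convergent incseq_bounded[of a s]) (auto simp: a_def mono_def)
  have "a 0 \<le> a N" for N
    using step by (auto intro: incseq_SucI incseqD)
  obtain \<delta> where \<delta>: "0 < \<delta>"
    "\<And>x y. \<lbrakk>a 0 \<le> x; x \<le> y; y \<le> s; y - x < \<delta>\<rbrakk> \<Longrightarrow> D x y < \<eta> / 3"
    using D_small[of "\<eta> / 3" "a 0" s] \<eta> by auto
  obtain M where M: "\<And>m n. M \<le> m \<Longrightarrow> M \<le> n \<Longrightarrow> \<bar>a m - a n\<bar> < \<delta>"
    using convergent_Cauchy[OF \<open>convergent a\<close>] \<delta>(1) unfolding Cauchy_def dist_real_def by metis
  have shrink: "D (a (Suc N)) (b (Suc N)) = D (a N) (b N) / 3" if "M \<le> N" for N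
  proof -
    have "D (a N) (a (Suc N)) < \<eta> / 3"
      using \<open>a 0 \<le> a N\<close> step[of N] K(1)[of "Suc N"] M[of N "Suc N"] that
      by (intro \<delta>(2)) (auto simp: a_def simp del: p.simps)
    then show ?thesis using step[of N] \<eta>(2)[of N] by linarith
  qed
  have geom: "D (a (M + n)) (b (M + n)) = D (a M) (b M) / 3 ^ n" for n
    by (induction n) (simp_all add: shrink)
  obtain n where "D (a M) (b M) / \<eta> < 3 ^ n" using real_arch_pow[of "3::real"] by auto
  then have "D (a M) (b M) / 3 ^ n < \<eta>" using \<eta>(1) by (simp add: field_simps)
  then show False using geom[of n] \<eta>(2)[of "M + n"] by simp
qed

end

text \<open>A loop for which adjacent triadic intervals of equal length have images of comparable diameter.\<close>

locale balanced_loop = loop +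
  assumes adjacent:
    "D (of_int k / 3 ^ N) (of_int (k + 1) / 3 ^ N)
       \<le> 3 * D (of_int (k + 1) / 3 ^ N) (of_int (k + 2) / 3 ^ N)"
    "D (of_int (k + 1) / 3 ^ N) (of_int (k + 2) / 3 ^ N)
       \<le> 3 * D (of_int k / 3 ^ N) (of_int (k + 1) / 3 ^ N)"

text \<open>
  The reparametrization \<open>u\<close> extends \<open>k / 3\<^sup>N \<mapsto> p N k\<close> to an increasing homeomorphism of the line.
\<close>

lemma (in triadic_subdivision) balanced_reparametrization:
  obtains u where "balanced_loop (\<gamma> \<circ> u)" "range (\<gamma> \<circ> u) = range \<gamma>"
proof -
  let ?P = "\<lambda>(N, k). p N k" and ?Q = "\<lambda>(N, k). of_int k / (3::real) ^ N"
  have denseQ: "\<exists>i. s < ?Q i \<and> ?Q i < t" if st: "s < t" for s t :: real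
  proof -
    obtain N where "1 / (t - s) < 3 ^ N" using real_arch_pow[of "3::real"] by auto
    then have N: "1 < (t - s) * 3 ^ N" using st by (simp add: field_simps)
    define k where "k = \<lfloor>s * 3 ^ N\<rfloor> + 1"
    have "s * 3 ^ N < k" "k < t * 3 ^ N" using N by (auto simp: k_def algebra_simps) linarith+
    then have "s < ?Q (N, k) \<and> ?Q (N, k) < t" by (simp add: field_simps)
    then show ?thesis by blast
  qed
  have denseP: "\<exists>i. s < ?P i \<and> ?P i < t" if "s < t" for s t :: real
    using p_dense[OF that] by auto
  have "?P i \<le> ?P j \<longleftrightarrow> ?Q i \<le> ?Q j" for i j
    by (cases i; cases j) (simp add: p_order)
  then obtain u where mono: "strict_mono u" and "surj u" and "\<And>i. u (?Q i) = ?P i"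
    using order_isomorphism_extension[of ?P ?Q] denseP denseQ by metis
  then have u: "u (of_int k / 3 ^ N) = p N k" for N k
    by (metis (mono_tags, lifting) case_prod_conv)
  have cont: "continuous_on UNIV u"
    using mono \<open>surj u\<close> by (intro continuous_onI_mono) (auto simp: strict_mono_less_eq)
  have image: "u ` {x..y} = {u x..u y}" for x y
  proof
    show "u ` {x..y} \<subseteq> {u x..u y}" using mono by (auto simp: strict_mono_less_eq)
    show "{u x..u y} \<subseteq> u ` {x..y}"
    proof
      fix z assume "z \<in> {u x..u y}"
      moreover obtain w where "z = u w" using \<open>surj u\<close> by (metis surjD)
      ultimately show "z \<in> u ` {x..y}" using mono by (auto simp: strict_mono_less_eq)
    qed
  qed
  have u_triadic_shift: "u (?Q i + of_int m) = u (?Q i) + of_int m" for i m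
  proof (cases i)
    case (Pair N k)
    have "?Q i + of_int m = of_int (k + m * 3 ^ N) / 3 ^ N" using Pair by (simp add: field_simps)
    then have "u (?Q i + of_int m) = p N (k + m * 3 ^ N)" by (simp only: u)
    then show ?thesis using Pair u by (simp add: p_shift)
  qed
  \<comment> \<open>A gap between the two sides would contain a point \<open>p N k\<close>, where the shift is already known.\<close>
  have u_shift: "u (x + of_int m) = u x + of_int m" for x m
  proof (rule linorder_cases[of "u (x + of_int m) - of_int m" "u x"])
    assume "u (x + of_int m) - of_int m < u x"
    then obtain i where i: "u (x + of_int m) - of_int m < ?P i" "?P i < u x" using denseP by blast
    then have "u (?Q i) < u x" "u (x + of_int m) < u (?Q i + of_int m)"
      using u u_triadic_shift[of i m] by (auto split: prod.splits)
    then show ?thesis using mono by (simp add: strict_mono_less)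
  next
    assume "u x < u (x + of_int m) - of_int m"
    then obtain i where i: "u x < ?P i" "?P i < u (x + of_int m) - of_int m" using denseP by blast
    then have "u x < u (?Q i)" "u (?Q i + of_int m) < u (x + of_int m)"
      using u u_triadic_shift[of i m] by (auto split: prod.splits)
    then show ?thesis using mono by (simp add: strict_mono_less)
  qed simp
  have int_iff: "u s - u t \<in> \<int> \<longleftrightarrow> s - t \<in> \<int>" for s t
  proof
    assume "u s - u t \<in> \<int>"
    then obtain m where "u s = u t + of_int m" by (auto elim!: Ints_cases simp: algebra_simps)
    then have "u s = u (t + of_int m)" by (simp add: u_shift)
    then have "s = t + of_int m" using mono by (simp add: strict_mono_eq)
    then show "s - t \<in> \<int>" by simp
  next
    assume "s - t \<in> \<int>"
    then obtain m where "s = t + of_int m" by (auto elim!: Ints_cases simp: algebra_simps)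
    then show "u s - u t \<in> \<int>" by (simp add: u_shift)
  qed
  interpret u: loop "\<gamma> \<circ> u"
  proof
    show "continuous_on UNIV (\<gamma> \<circ> u)"
      using cont continuous_on_subset[OF continuous subset_UNIV] by (rule continuous_on_compose)
    show "(\<gamma> \<circ> u) s = (\<gamma> \<circ> u) t \<longleftrightarrow> s - t \<in> \<int>" for s t
      by (simp add: eq_iff int_iff)
  qed
  have "u.D x y = D (u x) (u y)" for x y
    by (simp only: u.D_def D_def image_comp [symmetric] image)
  then have "balanced_loop (\<gamma> \<circ> u)"
    by unfold_locales (simp_all only: u p_adjacent)
  moreover have "range (\<gamma> \<circ> u) = range \<gamma>"
    using \<open>surj u\<close> by (metis image_comp)
  ultimately show ?thesis using that by blast
qed

lemma (in loop) balanced_reparametrization_exists: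
  obtains u where "balanced_loop (\<gamma> \<circ> u)" "range (\<gamma> \<circ> u) = range \<gamma>"
proof -
  obtain f g where "\<And>a b. a < b \<Longrightarrow> third_cut a b (f a b) (g a b)"
    "\<And>a b m. f (a + of_int m) (b + of_int m) = f a b + of_int m"
    "\<And>a b m. g (a + of_int m) (b + of_int m) = g a b + of_int m"
    using periodic_third_cuts by blast
  then interpret triadic_subdivision \<gamma> f g by unfold_locales
  show ?thesis using balanced_reparametrization that by blast
qed

section \<open>Balanced loops\<close>

context balanced_loop
begin

text \<open>The diameter of the image of the triadic interval \<open>[k / 3\<^sup>N, (k + 1) / 3\<^sup>N]\<close>.\<close>

definition T :: "nat \<Rightarrow> int \<Rightarrow> real"
  where "T N k = D (of_int k / 3 ^ N) (of_int (k + 1) / 3 ^ N)"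

lemma T_adjacent: "T N k \<le> 3 * T N (k + 1)" "T N (k + 1) \<le> 3 * T N k"
  using adjacent[of k N] by (simp_all add: T_def add.assoc)

lemma T_chain: "T N k \<le> 3 ^ m * T N (k + int m) \<and> T N (k + int m) \<le> 3 ^ m * T N k"
proof (induction m)
  case (Suc m)
  have "k + int (Suc m) = (k + int m) + 1" by simp
  moreover have "3 ^ m * T N (k + int m) \<le> 3 ^ m * (3 * T N (k + int m + 1))"
    using T_adjacent by (intro mult_left_mono) auto
  moreover have "3 * T N (k + int m) \<le> 3 * (3 ^ m * T N k)" using Suc by simp
  ultimately show ?case using Suc T_adjacent(2)[of N "k + int m"]
    by (simp only: power_Suc) linarith
qed simp

lemma T_le:
  assumes "\<bar>k - l\<bar> \<le> int n"
  shows "T N k \<le> 3 ^ n * T N l"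
proof -
  define m where "m = nat \<bar>k - l\<bar>"
  have "l = k + int m \<or> k = l + int m" by (auto simp: m_def)
  then have "T N k \<le> 3 ^ m * T N l" using T_chain by metis
  also have "\<dots> \<le> 3 ^ n * T N l"
    using assms by (intro mult_right_mono power_increasing) (auto simp: m_def T_def D_nonneg)
  finally show ?thesis .
qed

lemma D_triadic_le:
  assumes "\<And>j. j < n \<Longrightarrow> T N (k + int j) \<le> B"
  shows "D (of_int k / 3 ^ N) (of_int (k + int n) / 3 ^ N) \<le> real n * B"
  using assms
proof (induction n)
  case (Suc n)
  have "D (of_int k / 3 ^ N) (of_int (k + int (Suc n)) / 3 ^ N)
      \<le> D (of_int k / 3 ^ N) (of_int (k + int n) / 3 ^ N) + T N (k + int n)"
    unfolding T_def using D_triangle[of "of_int k / 3 ^ N" "of_int (k + int n) / 3 ^ N"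
      "of_int (k + int (Suc n)) / 3 ^ N"]
    by (simp add: divide_right_mono add.commute add.left_commute)
  also have "\<dots> \<le> real n * B + B"
    using Suc.prems by (intro add_mono Suc.IH) auto
  finally show ?case by (simp add: algebra_simps)
qed simp

text \<open>
  Take \<open>N\<close> with \<open>2 \<le> r * 3\<^sup>N < 6\<close>. Then \<open>[x - r, x + r]\<close> is covered by \<open>13\<close> triadic intervals of
  depth \<open>N\<close>, while \<open>[x, x + r]\<close> and \<open>[x - r, x]\<close> each contain one of these, which is at most
  \<open>7\<close> steps away from any other.
\<close>

lemma D_sym_le:
  assumes "0 < r" "r \<le> 1/2"
  shows "D (x - r) (x + r) \<le> 13 * 3 ^ 7 * D x (x + r)" "D (x - r) (x + r) \<le> 13 * 3 ^ 7 * D (x - r) x"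
proof -
  \<comment> \<open>The least \<open>N\<close> with \<open>2 \<le> r * 3\<^sup>N\<close>; it is not \<open>0\<close> because \<open>r \<le> 1/2\<close>.\<close>
  have "\<exists>N. 2 / r \<le> 3 ^ N" using real_arch_pow[of 3 "2 / r"] by (auto intro: less_imp_le)
  then obtain N where N: "2 / r \<le> 3 ^ N" "\<And>M. M < N \<Longrightarrow> \<not> 2 / r \<le> 3 ^ M"
    using exists_least_iff[of "\<lambda>N. 2 / r \<le> 3 ^ N"] by blast
  have lower: "2 \<le> r * 3 ^ N" using N(1) assms by (simp add: field_simps)
  have "N \<noteq> 0" using lower assms by (cases N) auto
  then obtain N' where N': "N = Suc N'" using not0_implies_Suc by blast
  then have "\<not> 2 / r \<le> 3 ^ N'" using N(2) by blast
  then have upper: "r * 3 ^ N < 6" using assms N' by (simp add: field_simps)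
  define k where "k = \<lfloor>x * 3 ^ N\<rfloor>"
  have k: "of_int k \<le> x * 3 ^ N" "x * 3 ^ N < of_int k + 1" unfolding k_def by linarith+
  have main: "D (x - r) (x + r) \<le> 13 * (3 ^ 7 * T N l)" if "l = k + 1 \<or> l = k - 1" for l
  proof -
    have "D (x - r) (x + r) \<le> D (of_int (k - 6) / 3 ^ N) (of_int (k - 6 + int 13) / 3 ^ N)"
      using k upper by (intro D_mono) (auto simp: field_simps)
    also have "\<dots> \<le> real 13 * (3 ^ 7 * T N l)"
      using that by (intro D_triadic_le T_le) auto
    finally show ?thesis by simp
  qed
  have "T N (k + 1) \<le> D x (x + r)" "T N (k - 1) \<le> D (x - r) x"
    unfolding T_def using k lower by (auto intro!: D_mono simp: field_simps)
  then show "D (x - r) (x + r) \<le> 13 * 3 ^ 7 * D x (x + r)" "D (x - r) (x + r) \<le> 13 * 3 ^ 7 * D (x - r) x"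
    using main[of "k + 1"] main[of "k - 1"] by auto
qed

end

section \<open>Arcs of a Jordan curve\<close>

lemma arcs_between_bounded: "A \<in> arcs_between M x y \<Longrightarrow> bounded A"
  unfolding arcs_between_def by (auto intro: bounded_arc_image)

context loop
begin

lemma loop_not_eq: "\<lbrakk>s < t; t < s + 1\<rbrakk> \<Longrightarrow> \<gamma> s \<noteq> \<gamma> t"
  using not_Ints_between[of "t - s"] eq_iff[of t s] by auto

text \<open>
  If \<open>S\<close> missed an interior point of each of the two arcs between \<open>\<gamma> s\<close> and \<open>\<gamma> t\<close>, then removing
  these two points from the curve would separate \<open>\<gamma> s\<close> from \<open>\<gamma> t\<close> in \<open>S\<close>.
\<close>

lemma connected_contains_arc:
  assumes st: "s < t" "t < s + 1"
    and S: "connected S" "S \<subseteq> range \<gamma>" "\<gamma> s \<in> S" "\<gamma> t \<in> S"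
  shows "\<gamma> ` {s..t} \<subseteq> S \<or> \<gamma> ` {t..s + 1} \<subseteq> S"
proof (rule ccontr)
  assume "\<not> ?thesis"
  then obtain u v where uv: "u \<in> {s..t}" "\<gamma> u \<notin> S" "v \<in> {t..s + 1}" "\<gamma> v \<notin> S" by blast
  have "\<gamma> (s + 1) = \<gamma> s" using shift[of s 1] by simp
  then have "u \<noteq> s" "u \<noteq> t" "v \<noteq> t" "v \<noteq> s + 1" using uv S by metis+
  with uv have less: "s < u" "u < t" "t < v" "v < s + 1" by auto
  define A B where "A = - \<gamma> ` {v..u + 1}" and "B = - \<gamma> ` {u..v}"
  have "open A" "open B" unfolding A_def B_def
    by (intro open_Compl compact_imp_closed compact_image compact_Icc)+
  moreover have "\<gamma> s \<in> B \<inter> S"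
  proof -
    have "\<gamma> s \<noteq> \<gamma> x" if "x \<in> {u..v}" for x using that less by (intro loop_not_eq) auto
    then show ?thesis using S unfolding B_def by blast
  qed
  moreover have "\<gamma> t \<in> A \<inter> S"
  proof -
    have "\<gamma> t \<noteq> \<gamma> x" if "x \<in> {v..u + 1}" for x using that less by (intro loop_not_eq) auto
    then show ?thesis using S unfolding A_def by blast
  qed
  moreover have "S \<subseteq> A \<union> B"
  proof
    fix y assume "y \<in> S"
    show "y \<in> A \<union> B"
    proof (rule ccontr)
      assume "y \<notin> A \<union> B"
      then obtain a b where ab: "a \<in> {v..u + 1}" "b \<in> {u..v}" "y = \<gamma> a" "y = \<gamma> b"
        by (auto simp: A_def B_def)
      then have "a - b \<in> \<int>" by (metis eq_iff)
      then consider "a = b" | "a = b + 1"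
        using ab Ints_abs_less_1[of "a - b"] less by fastforce
      then show False
      proof cases
        case 1
        then show False using ab uv \<open>y \<in> S\<close> by auto
      next
        case 2
        then have "b = u" using ab by auto
        then show False using ab uv \<open>y \<in> S\<close> by auto
      qed
    qed
  qed
  moreover have "A \<inter> B \<inter> S = {}"
  proof -
    have "y \<notin> A \<inter> B" if "y \<in> S" for y
    proof -
      obtain x where "y = \<gamma> x" using S \<open>y \<in> S\<close> by blast
      \<comment> \<open>The parameter of \<open>y\<close> in the period \<open>[u, u + 1)\<close>.\<close>
      define w where "w = u + frac (x - u)"
      have "w - x \<in> \<int>" by (simp add: w_def frac_def)
      then have "y = \<gamma> w" using \<open>y = \<gamma> x\<close> by (simp add: eq_iff[of w x, symmetric])
      moreover have "w \<in> {u..v} \<or> w \<in> {v..u + 1}"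
        using frac_ge_0[of "x - u"] frac_lt_1[of "x - u"] by (auto simp: w_def)
      ultimately show ?thesis by (auto simp: A_def B_def)
    qed
    then show ?thesis by blast
  qed
  ultimately show False using connectedD[OF S(1), of A B] by blast
qed

lemma segment_in_arcs_between:
  assumes "s \<noteq> t" "\<bar>s - t\<bar> < 1"
  shows "\<gamma> ` closed_segment s t \<in> arcs_between (range \<gamma>) (\<gamma> s) (\<gamma> t)"
proof -
  let ?g = "\<gamma> \<circ> linepath s t"
  have "path ?g"
    by (intro path_continuous_image path_linepath continuous_on_subset[OF continuous subset_UNIV])
  moreover have "inj_on ?g {0..1}"
  proof (rule inj_onI)
    fix x y :: real assume xy: "x \<in> {0..1}" "y \<in> {0..1}" "?g x = ?g y"
    have "linepath s t x - linepath s t y = (x - y) * (t - s)"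
      by (simp add: linepath_def algebra_simps)
    then have "(x - y) * (t - s) \<in> \<int>" using xy by (simp add: eq_iff)
    moreover have "\<bar>(x - y) * (t - s)\<bar> < 1"
    proof -
      have "\<bar>(x - y) * (t - s)\<bar> \<le> 1 * \<bar>s - t\<bar>"
        unfolding abs_mult abs_minus_commute[of t] using xy by (intro mult_right_mono) auto
      also have "\<dots> < 1" using assms(2) by simp
      finally show ?thesis .
    qed
    ultimately show "x = y" using Ints_abs_less_1 assms by fastforce
  qed
  ultimately have "arc ?g" by (simp add: arc_def)
  moreover have "path_image ?g = \<gamma> ` closed_segment s t"
    by (simp only: path_image_compose path_image_linepath)
  moreover have "pathstart ?g = \<gamma> s" "pathfinish ?g = \<gamma> t"
    by (simp_all add: pathstart_compose pathfinish_compose)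
  ultimately show ?thesis unfolding arcs_between_def by blast
qed

lemma arcs_between_contains:
  assumes "s < t" "t < s + 1"
    and A: "A \<in> arcs_between (range \<gamma>) (\<gamma> s) (\<gamma> t) \<or> A \<in> arcs_between (range \<gamma>) (\<gamma> t) (\<gamma> s)"
  shows "\<gamma> ` {s..t} \<subseteq> A \<or> \<gamma> ` {t..s + 1} \<subseteq> A"
proof -
  obtain h where h: "arc h" "A = path_image h" "A \<subseteq> range \<gamma>"
      "pathstart h = \<gamma> s \<and> pathfinish h = \<gamma> t \<or> pathstart h = \<gamma> t \<and> pathfinish h = \<gamma> s"
    using A unfolding arcs_between_def by auto
  have "\<gamma> s \<in> A" "\<gamma> t \<in> A"
    using h(4) pathstart_in_path_image[of h] pathfinish_in_path_image[of h] unfolding h(2) by auto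
  moreover have "connected A" using h(1,2) connected_arc_image by blast
  ultimately show ?thesis
    using connected_contains_arc[OF assms(1,2), of A] h(3) by blast
qed

text \<open>
  Every arc between \<open>x\<close> and \<open>y\<close> contains one of the two images of parameter intervals, so the one of
  these two with the smaller diameter is a smaller arc.
\<close>

lemma smaller_arc_exists:
  assumes "K \<in> arcs_between (range \<gamma>) x y" "x \<noteq> y"
  shows "\<exists>A. is_smaller_arc (range \<gamma>) x y A \<and> diameter A \<le> diameter K"
proof -
  have "x \<in> range \<gamma>" "y \<in> range \<gamma>" using assms(1) unfolding arcs_between_def by fastforce+
  then obtain s t0 where s: "x = \<gamma> s" "y = \<gamma> t0" by blast
  define t where "t = s + frac (t0 - s)"
  have "t - t0 \<in> \<int>" by (simp add: t_def frac_def)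
  then have t: "y = \<gamma> t" using s by (simp add: eq_iff[of t t0, symmetric])
  have "s \<noteq> t" using t s assms by auto
  then have st: "s < t" "t < s + 1"
    using frac_ge_0[of "t0 - s"] frac_lt_1[of "t0 - s"] by (auto simp: t_def)
  define A1 A2 where "A1 = \<gamma> ` {s..t}" and "A2 = \<gamma> ` {t..s + 1}"
  have "\<gamma> (s + 1) = \<gamma> s" using shift[of s 1] by simp
  then have mem: "A1 \<in> arcs_between (range \<gamma>) x y" "A2 \<in> arcs_between (range \<gamma>) x y"
    using segment_in_arcs_between[of s t] segment_in_arcs_between[of "s + 1" t] st s t
    by (auto simp: A1_def A2_def closed_segment_eq_real_ivl)
  have min: "diameter A1 \<le> diameter B \<or> diameter A2 \<le> diameter B"
    if "B \<in> arcs_between (range \<gamma>) x y" for B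
    using arcs_between_contains[OF st, of B] that s t arcs_between_bounded[OF that]
    by (auto simp: A1_def A2_def intro: diameter_subset)
  define A where "A = (if diameter A1 \<le> diameter A2 then A1 else A2)"
  have "diameter A \<le> diameter B" if "B \<in> arcs_between (range \<gamma>) x y" for B
    using min[OF that] by (auto simp: A_def)
  moreover have "A \<in> arcs_between (range \<gamma>) x y" using mem by (simp add: A_def)
  ultimately show ?thesis using assms(1) unfolding is_smaller_arc_def by blast
qed

end

lemma metric_Jordan_curve_loop:
  assumes "metric_Jordan_curve \<Gamma>"
  obtains \<gamma> where "loop \<gamma>" "range \<gamma> = \<Gamma>"
proof -
  obtain h f where hom: "homeomorphism \<Gamma> (sphere (0::complex) 1) h f"
    using assms unfolding metric_Jordan_curve_def homeomorphic_def by blast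
  define \<gamma> where "\<gamma> = (\<lambda>t. f (cis (2 * pi * t)))"
  have cis: "cis (2 * pi * s) = cis (2 * pi * t) \<longleftrightarrow> s - t \<in> \<int>" for s t
  proof -
    have "cis (2 * pi * s) = cis (2 * pi * t) \<longleftrightarrow> (\<exists>n::int. 2 * pi * s = 2 * pi * t + 2 * pi * n)"
      using sin_cos_eq_iff[of "2 * pi * s" "2 * pi * t"] by (auto simp: complex_eq_iff)
    also have "\<dots> \<longleftrightarrow> (\<exists>n::int. 2 * pi * s = 2 * pi * (t + n))"
      by (simp only: distrib_left)
    also have "\<dots> \<longleftrightarrow> (\<exists>n::int. s - t = n)"
      by (simp only: mult_cancel_left) (simp add: diff_eq_eq add.commute)
    also have "\<dots> \<longleftrightarrow> s - t \<in> \<int>" by (auto simp: Ints_def)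
    finally show ?thesis .
  qed
  have "continuous_on UNIV \<gamma>" unfolding \<gamma>_def
    by (rule continuous_on_compose2[OF homeomorphism_cont2[OF hom]])
       (auto intro!: continuous_intros)
  moreover have "\<gamma> s = \<gamma> t \<longleftrightarrow> s - t \<in> \<int>" for s t
  proof -
    have "h (f z) = z" if "norm z = 1" for z using hom that by (simp add: homeomorphism_def)
    then have "\<gamma> s = \<gamma> t \<longleftrightarrow> cis (2 * pi * s) = cis (2 * pi * t)"
      unfolding \<gamma>_def by (metis norm_cis)
    then show ?thesis using cis by simp
  qed
  ultimately have "loop \<gamma>" by unfold_locales
  moreover have "range \<gamma> = \<Gamma>"
  proof -
    have "z \<in> range (\<lambda>t. cis (2 * pi * t))" if "norm z = 1" for z
    proof
      show "z = cis (2 * pi * (Arg z / (2 * pi)))"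
        using that cis_Arg[of z] by (force simp: sgn_div_norm)
    qed simp
    then have "range (\<lambda>t. cis (2 * pi * t)) = sphere 0 1" by auto
    then have "f ` range (\<lambda>t. cis (2 * pi * t)) = \<Gamma>" using hom by (simp add: homeomorphism_def)
    then show ?thesis by (simp add: \<gamma>_def image_image)
  qed
  ultimately show ?thesis using that by blast
qed

section \<open>The unit circle as a quotient of the line\<close>

text \<open>The projection of the real line onto the circle. It is isometric at distances up to \<open>1/2\<close>.\<close>

definition circ :: "real \<Rightarrow> S1"
  where "circ t = abs_S1 (frac t)"

lemma circ_shift: "circ (t + of_int m) = circ t"
  by (simp add: circ_def frac_def)

lemma dist_circ:
  assumes "\<bar>s - t\<bar> \<le> 1/2"
  shows "dist (circ s) (circ t) = \<bar>s - t\<bar>"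
proof -
  have "dist (circ s) (circ t) = arc_length_dist (frac s) (frac t)"
    unfolding circ_def
    by (intro dist_S1.abs_eq) (auto simp: circle_rel_def less_imp_le[OF frac_lt_1])
  also have "\<dots> = \<bar>s - t\<bar>"
  proof -
    define n where "n = \<lfloor>s\<rfloor> - \<lfloor>t\<rfloor>"
    have st: "s - t = frac s - frac t + of_int n" by (simp add: n_def frac_def)
    have "n = 0 \<or> n = 1 \<or> n = -1"
      using assms unfolding n_def by linarith
    then show ?thesis
      using assms frac_ge_0[of s] frac_lt_1[of s] frac_ge_0[of t] frac_lt_1[of t]
      unfolding st arc_length_dist_def min_def by (elim disjE) (auto simp: abs_if split: if_splits)
  qed
  finally show ?thesis .
qed

lemma circ_surj: "\<exists>t. X = circ t"
proof -
  obtain t where t: "circle_rel t t" "X = abs_S1 t"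
    using Quotient_S1 by (metis Quotient_alt_def2 Quotient_rel_rep Quotient_abs_rep)
  show ?thesis
  proof (cases "t = 1")
    case True
    have "circle_rel 1 0" by (auto simp: circle_rel_def)
    then have "abs_S1 1 = abs_S1 0" using Quotient_rel_abs[OF Quotient_S1] by blast
    then have "X = circ 0" using t True by (simp add: circ_def)
    then show ?thesis ..
  next
    case False
    then have "frac t = t" using t by (auto simp: circle_rel_def frac_eq)
    then show ?thesis using t by (metis circ_def)
  qed
qed

text \<open>Any point of the circle has a lift at distance at most half a period from a given \<open>s\<close>.\<close>

lemma circ_lift:
  obtains t where "X = circ t" "\<bar>s - t\<bar> \<le> 1/2"
proof -
  obtain t0 where "X = circ t0" using circ_surj by blast
  then have "X = circ (t0 + of_int (round (s - t0)))" by (simp add: circ_shift)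
  moreover have "\<bar>s - (t0 + of_int (round (s - t0)))\<bar> \<le> 1/2"
    using of_int_round_abs_le[of "s - t0"] by (simp add: abs_minus_commute algebra_simps)
  ultimately show ?thesis using that by blast
qed

lemma circ_eq_iff: "circ s = circ t \<longleftrightarrow> s - t \<in> \<int>"
proof
  assume eq: "circ s = circ t"
  let ?t = "t + of_int (round (s - t))"
  have "\<bar>s - ?t\<bar> \<le> 1/2"
    using of_int_round_abs_le[of "s - t"] by (simp add: abs_minus_commute algebra_simps)
  then have "\<bar>s - ?t\<bar> = 0" using dist_circ[of s ?t] eq by (simp add: circ_shift)
  then have "s - t = of_int (round (s - t))" by simp
  then show "s - t \<in> \<int>" by (metis Ints_of_int)
next
  assume "s - t \<in> \<int>"
  then obtain m where "s = t + of_int m" by (auto elim!: Ints_cases simp: algebra_simps)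
  then show "circ s = circ t" by (simp add: circ_shift)
qed

lemma continuous_circ: "continuous_on UNIV circ"
  unfolding continuous_on_iff
proof safe
  fix x e :: real assume "0 < e"
  then show "\<exists>d>0. \<forall>x'\<in>UNIV. dist x' x < d \<longrightarrow> dist (circ x') (circ x) < e"
    by (intro exI[of _ "min e (1/2)"]) (auto simp: dist_real_def dist_circ)
qed

section \<open>Bounded turning and weak quasisymmetry\<close>

text \<open>
  The points \<open>a\<close> of the shorter circular arc from \<open>s\<close> to \<open>t\<close> are no farther from \<open>s\<close> than \<open>t\<close> is, so
  the image of this arc lies within \<open>H * dist x y\<close> of \<open>x\<close> and has diameter at most \<open>2 * H * dist x y\<close>.
\<close>

lemma weak_quasisymmetric_imp_bounded_turning:
  assumes "weak_quasisymmetric_homeomorphism (UNIV :: S1 set) \<Gamma> \<phi>"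
  shows "bounded_turning \<Gamma>"
proof -
  obtain \<psi> H where hom: "homeomorphism UNIV \<Gamma> \<phi> \<psi>" and H: "1 \<le> H"
    "\<And>x y z. dist x y \<le> dist x z \<Longrightarrow> dist (\<phi> x) (\<phi> y) \<le> H * dist (\<phi> x) (\<phi> z)"
    using assms unfolding weak_quasisymmetric_homeomorphism_def by auto
  have "inj \<phi>" using hom by (metis UNIV_I homeomorphism_apply1 injI)
  define \<gamma> where "\<gamma> = \<phi> \<circ> circ"
  interpret loop \<gamma>
  proof
    show "continuous_on UNIV \<gamma>" unfolding \<gamma>_def
      using continuous_circ continuous_on_subset[OF homeomorphism_cont1[OF hom] subset_UNIV]
      by (rule continuous_on_compose)
    show "\<gamma> s = \<gamma> t \<longleftrightarrow> s - t \<in> \<int>" for s t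
      using \<open>inj \<phi>\<close> by (simp add: \<gamma>_def inj_eq circ_eq_iff)
  qed
  have "range circ = UNIV" using circ_surj by blast
  then have range: "range \<gamma> = \<Gamma>"
    using homeomorphism_image1[OF hom] by (simp only: \<gamma>_def image_comp [symmetric])
  have "\<exists>A. is_smaller_arc \<Gamma> x y A \<and> diameter A \<le> 2 * H * dist x y"
    if xy: "x \<in> \<Gamma>" "y \<in> \<Gamma>" "x \<noteq> y" for x y
  proof -
    obtain s where s: "x = \<gamma> s" using xy range by blast
    obtain t0 where "y = \<gamma> t0" using xy range by blast
    moreover obtain t where "circ t0 = circ t" and st: "\<bar>s - t\<bar> \<le> 1/2" using circ_lift by blast
    ultimately have t: "y = \<gamma> t" by (simp add: \<gamma>_def)
    let ?K = "\<gamma> ` closed_segment s t"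
    have "?K \<in> arcs_between \<Gamma> x y"
      using segment_in_arcs_between[of s t] s t st xy range by force
    then obtain A where A: "is_smaller_arc \<Gamma> x y A" "diameter A \<le> diameter ?K"
      using smaller_arc_exists xy range by blast
    have near: "dist x (\<gamma> a) \<le> H * dist x y" if "a \<in> closed_segment s t" for a
    proof -
      have "\<bar>s - a\<bar> \<le> \<bar>s - t\<bar>" using that by (auto simp: closed_segment_eq_real_ivl split: if_splits)
      then have "dist (circ s) (circ a) \<le> dist (circ s) (circ t)"
        using st by (simp add: dist_circ)
      then show ?thesis using H(2) s t by (simp add: \<gamma>_def)
    qed
    have "dist (\<gamma> a) (\<gamma> b) \<le> 2 * H * dist x y"
      if "a \<in> closed_segment s t" "b \<in> closed_segment s t" for a b
      using near[OF that(1)] near[OF that(2)] dist_triangle3[of "\<gamma> a" "\<gamma> b" x] by linarith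
    then have "diameter ?K \<le> 2 * H * dist x y"
      by (auto simp: diameter_def intro!: cSUP_least)
    with A show ?thesis by force
  qed
  then show ?thesis unfolding bounded_turning_def using H(1) by (intro exI[of _ "2 * H"]) auto
qed

text \<open>
  Let \<open>r\<close> be the distance from \<open>X\<close> to \<open>Z\<close>, and let \<open>s\<close> be a lift of \<open>X\<close>. Each of the two arcs between
  \<open>\<phi> X\<close> and \<open>\<phi> Z\<close> contains the image of \<open>[s, s + r]\<close> or of \<open>[s - r, s]\<close>, whose diameters are comparable
  to that of the image of \<open>[s - r, s + r]\<close>, which contains \<open>\<phi> Y\<close>. Bounded turning compares the
  diameter of one of these arcs with \<open>dist (\<phi> X) (\<phi> Z)\<close>.
\<close>

lemma (in balanced_loop) bounded_turning_imp_weak_quasisymmetric: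
  assumes "bounded_turning (range \<gamma>)"
  shows "\<exists>\<phi>. weak_quasisymmetric_homeomorphism (UNIV :: S1 set) (range \<gamma>) \<phi>"
proof -
  obtain C where C: "1 \<le> C" "\<And>x y. \<lbrakk>x \<in> range \<gamma>; y \<in> range \<gamma>; x \<noteq> y\<rbrakk> \<Longrightarrow>
      \<exists>A. is_smaller_arc (range \<gamma>) x y A \<and> diameter A \<le> C * dist x y"
    using assms unfolding bounded_turning_def by blast
  define \<phi> where "\<phi> = (\<lambda>X. \<gamma> (SOME t. X = circ t))"
  have \<phi>: "\<phi> (circ t) = \<gamma> t" for t
  proof -
    have "circ t = circ (SOME t'. circ t = circ t')" by (rule someI) simp
    then show ?thesis by (simp add: \<phi>_def circ_eq_iff eq_iff) (metis Ints_minus minus_diff_eq)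
  qed
  have "continuous_on UNIV \<phi>"
    unfolding continuous_on_iff
  proof safe
    fix X :: S1 and e :: real assume "0 < e"
    obtain s where s: "X = circ s" using circ_surj by blast
    obtain d where d: "0 < d" "\<And>t. dist t s < d \<Longrightarrow> dist (\<gamma> t) (\<gamma> s) < e"
      using continuous \<open>0 < e\<close> unfolding continuous_on_iff by blast
    have "dist (\<phi> Y) (\<phi> X) < e" if "dist Y X < d" for Y
    proof -
      obtain t where "Y = circ t" "\<bar>s - t\<bar> \<le> 1/2" using circ_lift by blast
      then show ?thesis using that d(2)[of t] dist_circ[of s t] s
        by (simp add: \<phi> dist_commute dist_real_def)
    qed
    with d(1) show "\<exists>d>0. \<forall>Y\<in>UNIV. dist Y X < d \<longrightarrow> dist (\<phi> Y) (\<phi> X) < e" by blast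
  qed
  moreover have "compact (UNIV :: S1 set)"
  proof -
    have "circ ` {0..1} = UNIV"
    proof -
      have "X \<in> circ ` {0..1}" for X
      proof -
        obtain t where "X = circ t" using circ_surj by blast
        then have "X = circ (frac t)" by (simp add: circ_def)
        then show ?thesis using frac_ge_0[of t] frac_lt_1[of t] by auto
      qed
      then show ?thesis by blast
    qed
    then show ?thesis
      using compact_continuous_image[OF continuous_on_subset[OF continuous_circ subset_UNIV]]
      by (metis compact_Icc)
  qed
  moreover have "\<phi> ` UNIV = range \<gamma>"
  proof -
    have "range circ = UNIV" using circ_surj by blast
    then have "\<phi> ` UNIV = (\<lambda>t. \<phi> (circ t)) ` UNIV" by (metis image_image)
    then show ?thesis by (simp add: \<phi>)
  qed
  moreover have "inj_on \<phi> UNIV"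
  proof (rule injI)
    fix X Y assume "\<phi> X = \<phi> Y"
    moreover obtain s t where "X = circ s" "Y = circ t" using circ_surj by metis
    ultimately show "X = Y" by (simp add: \<phi> circ_eq_iff eq_iff)
  qed
  ultimately have "\<exists>\<psi>. homeomorphism UNIV (range \<gamma>) \<phi> \<psi>"
    using homeomorphism_compact by blast
  moreover have "dist (\<phi> X) (\<phi> Y) \<le> (13 * 3 ^ 7 * C) * dist (\<phi> X) (\<phi> Z)"
    if XYZ: "dist X Y \<le> dist X Z" for X Y Z
  proof -
    obtain s where s: "X = circ s" using circ_surj by blast
    obtain y where y: "Y = circ y" "\<bar>s - y\<bar> \<le> 1/2" using circ_lift by blast
    obtain z where z: "Z = circ z" "\<bar>s - z\<bar> \<le> 1/2" using circ_lift by blast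
    define r where "r = \<bar>s - z\<bar>"
    have r: "\<bar>s - y\<bar> \<le> r" "r \<le> 1/2" using XYZ s y z by (simp_all add: r_def dist_circ)
    show ?thesis
    proof (cases "r = 0")
      case True
      then show ?thesis using r C(1) s y by simp
    next
      case False
      then have "0 < r" by (simp add: r_def)
      have "X \<noteq> Z" using dist_circ[of s z] s z False by (auto simp: r_def)
      then have "\<gamma> s \<noteq> \<gamma> z" using s z by (simp add: circ_eq_iff eq_iff)
      then obtain A where A: "A \<in> arcs_between (range \<gamma>) (\<gamma> s) (\<gamma> z)"
        and diamA: "diameter A \<le> C * dist (\<gamma> s) (\<gamma> z)"
        using C(2) unfolding is_smaller_arc_def by blast
      have "bounded A" using A by (rule arcs_between_bounded)
      \<comment> \<open>The complementary arc has length \<open>1 - r \<ge> r\<close>.\<close>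
      have "\<gamma> ` {s..s + r} \<subseteq> A \<or> \<gamma> ` {s - r..s} \<subseteq> A"
      proof -
        consider "z = s + r" | "z = s - r" unfolding r_def by linarith
        then show ?thesis
        proof cases
          case 1
          have "\<gamma> ` {s - r..s} = \<gamma> ` {s - r + 1..s + 1}"
            using image_shift[of "s - r" 1 s] by simp
          also have "\<dots> \<subseteq> \<gamma> ` {z..s + 1}" using 1 r by (intro image_mono) auto
          finally show ?thesis
            using arcs_between_contains[of s z A] A 1 r \<open>0 < r\<close> by auto
        next
          case 2
          have "\<gamma> ` {s..s + r} \<subseteq> \<gamma> ` {s..z + 1}" using 2 r by (intro image_mono) auto
          then show ?thesis
            using arcs_between_contains[of z s A] A 2 r \<open>0 < r\<close> by auto
        qed
      qed
      then have "D s (s + r) \<le> diameter A \<or> D (s - r) s \<le> diameter A"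
        using \<open>bounded A\<close> diameter_subset unfolding D_def by blast
      then have "D (s - r) (s + r) \<le> 13 * 3 ^ 7 * diameter A"
        using D_sym_le[OF \<open>0 < r\<close> r(2), of s] by auto
      moreover have "dist (\<gamma> s) (\<gamma> y) \<le> D (s - r) (s + r)"
        using r by (intro dist_le_D) auto
      ultimately show ?thesis using diamA s y z by (simp add: \<phi>)
    qed
  qed
  moreover have "1 \<le> 13 * 3 ^ 7 * C" using C(1) by simp
  ultimately show ?thesis unfolding weak_quasisymmetric_homeomorphism_def by blast
qed

theorem theorem1p1:
  fixes \<Gamma> :: "'a::metric_space set"
  assumes "metric_Jordan_curve \<Gamma>"
  shows "bounded_turning \<Gamma> \<longleftrightarrow>
    (\<exists>\<phi>. weak_quasisymmetric_homeomorphism (UNIV :: S1 set) \<Gamma> \<phi>)"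
proof
  assume bt: "bounded_turning \<Gamma>"
  obtain \<gamma> where \<gamma>: "loop \<gamma>" "range \<gamma> = \<Gamma>"
    using metric_Jordan_curve_loop[OF assms] .
  obtain u where u: "balanced_loop (\<gamma> \<circ> u)" "range (\<gamma> \<circ> u) = range \<gamma>"
    using loop.balanced_reparametrization_exists[OF \<gamma>(1)] .
  have "bounded_turning (range (\<gamma> \<circ> u))" using bt by (simp only: u(2) \<gamma>(2))
  from balanced_loop.bounded_turning_imp_weak_quasisymmetric[OF u(1) this]
  show "\<exists>\<phi>. weak_quasisymmetric_homeomorphism (UNIV :: S1 set) \<Gamma> \<phi>"
    by (simp only: u(2) \<gamma>(2))
next
  assume "\<exists>\<phi>. weak_quasisymmetric_homeomorphism (UNIV :: S1 set) \<Gamma> \<phi>"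
  then show "bounded_turning \<Gamma>" using weak_quasisymmetric_imp_bounded_turning by blast
qed

end
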